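(* Let $\mu$ be a non-trivial probability measure supported on $[-1,1]$ with recurrence coefficients $\{b_n\}_{n\ge1}$, $\{d_n\}_{n\ge1}$, let $\sigma=\mathrm{Sz}(\mu)$ with Verblunsky coefficients $\{\alpha_n\}_{n\ge0}$ and monic orthogonal polynomials $\{\Phi_n\}_{n\ge0}$. Let $k\ge1$ and let $\{\hat b_n\}_{n\ge1}$, $\{\hat d_n\}_{n\ge1}$ be the recurrence coefficients of the orthogonal polynomials on the real line corresponding, through the Szegő transformation, to the associated polynomials of order $k$ on the unit circle, $\{\Phi^{(k)}_n\}_{n\ge0}$. Put $v_n=\frac12(1+\alpha_n)(1-\alpha_{n-1})$, with $m\geq 1$ an integer. (i) If $k=2m-1$, then $$\hat d_1=\frac{1+\alpha_{2m-1}}{v_{2m+1}}\,d_{m+1},\qquad \hat d_{n+1}=\frac{v_{2(n+m)-1}}{v_{2(n+m)+1}}\,d_{n+m+1},\quad n\ge1,$$ $$\hat b_1=\alpha_{2m-1},\qquad \hat b_{n+1}=b_{n+m+1}+v_{2(n+m)-2}-v_{2(n+m)},\quad n\ge1.$$ (ii) If $k=2m$, then, with $\lambda=\dfrac{2}{1-\alpha_{2m-1}}$, $$\hat d_1=\lambda\,d_{m+1},\qquad \hat d_{n+1}=d_{n+m+1},\quad n\ge1,$$ $$\hat b_1=\alpha_{2m},\qquad \hat b_{n+1}=b_{n+m+1},\quad n\ge1.$$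
   Context: For a non-trivial probability measure on $[-1,1]$, the recurrence coefficients $b_n\in\mathbb R$, $d_n>0$ ($n\ge1$) are those of its monic orthogonal polynomials: $P_{n+1}(x)=(x-b_{n+1})P_n(x)-d_nP_{n-1}(x)$, $n\ge0$, $P_{-1}=0$, $P_0=1$. For a non-trivial probability measure on the unit circle with monic orthogonal polynomials $\Phi_n$, the Verblunsky coefficients are $\alpha_n=-\overline{\Phi_{n+1}(0)}$, $n\ge0$, and $\Phi_{n+1}(z)=z\Phi_n(z)-\overline{\alpha_n}\Phi_n^*(z)$, $\Phi_0=1$, with $\Phi_n^*(z)=z^n\overline{\Phi_n(1/\bar z)}$. The associated polynomials of order $k$ on the unit circle are given by $\Phi^{(k)}_{n+1}(z)=z\Phi^{(k)}_n(z)-\overline{\alpha_{n+k}}\,(\Phi_n^{(k)})^*(z)$, $n\ge0$, $\Phi_0^{(k)}=1$, i.e. they have Verblunsky coefficients $\{\alpha_{n+k}\}_{n\ge0}$; they are orthogonal with respect to a probability measure $\sigma^{(k)}$ on the unit circle. Szegő transformation: a probability measure $\nu$ on $[-1,1]$ is sent to the probability measure $\mathrm{Sz}(\nu)$ on the unit circle given by $d\,\mathrm{Sz}(\nu)(\theta)=\frac12|d\nu(\cos\theta)|$, i.e. the measure invariant under $\theta\mapsto-\theta$ whose push-forward under $e^{i\theta}\mapsto\cos\theta$ is $\nu$. The Verblunsky coefficients of $\mathrm{Sz}(\nu)$ are in $(-1,1)$, and each probability measure on the circle with all Verblunsky coefficients in $(-1,1)$ is $\mathrm{Sz}(\nu)$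 for a unique $\nu$. The coefficients $\hat b_n,\hat d_n$ are those of the measure $\hat\mu$ on $[-1,1]$ with $\mathrm{Sz}(\hat\mu)=\sigma^{(k)}$. *)

theory Defs
  imports "HOL-Probability.Probability" "HOL-Computational_Algebra.Polynomial"
begin

definition prob_on :: "'a::topological_space set \<Rightarrow> 'a measure \<Rightarrow> bool" where
  "prob_on S M \<longleftrightarrow> prob_space M \<and> sets M = sets borel \<and> (AE x in M. x \<in> S)"

definition nontrivial_prob_on :: "'a::topological_space set \<Rightarrow> 'a measure \<Rightarrow> bool" where
  "nontrivial_prob_on S M \<longleftrightarrow>
     prob_on S M \<and> (\<forall>F. finite F \<longrightarrow> \<not> (AE x in M. x \<in> F))"

definition monic_oprl :: "real measure \<Rightarrow> (nat \<Rightarrow> real poly) \<Rightarrow> bool" where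
  "monic_oprl \<mu> P \<longleftrightarrow>
     (\<forall>n. degree (P n) = n \<and> lead_coeff (P n) = 1) \<and>
     (\<forall>i j. i \<noteq> j \<longrightarrow> (\<integral>x. poly (P i) x * poly (P j) x \<partial>\<mu>) = 0)"

text \<open>The values \<open>b 0\<close> and \<open>d 0\<close> are unconstrained: the coefficients are indexed from 1,
  and the guard at \<open>n = 0\<close> renders the convention that the polynomial of index -1 is zero.\<close>

definition recurrence_coeffs ::
  "real measure \<Rightarrow> (nat \<Rightarrow> real) \<Rightarrow> (nat \<Rightarrow> real) \<Rightarrow> bool" where
  "recurrence_coeffs \<mu> b d \<longleftrightarrow>
     (\<exists>P. monic_oprl \<mu> P \<and>
        (\<forall>n. P (n + 1) = [:- b (n + 1), 1:] * P n
                          - (if n = 0 then 0 else smult (d n) (P (n - 1)))))"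

definition monic_opuc :: "complex measure \<Rightarrow> (nat \<Rightarrow> complex poly) \<Rightarrow> bool" where
  "monic_opuc \<sigma> \<Phi> \<longleftrightarrow>
     (\<forall>n. degree (\<Phi> n) = n \<and> lead_coeff (\<Phi> n) = 1) \<and>
     (\<forall>i j. i \<noteq> j \<longrightarrow> (\<integral>z. poly (\<Phi> i) z * cnj (poly (\<Phi> j) z) \<partial>\<sigma>) = 0)"

definition verblunsky :: "(nat \<Rightarrow> complex poly) \<Rightarrow> nat \<Rightarrow> complex" where
  "verblunsky \<Phi> n = - cnj (poly (\<Phi> (n + 1)) 0)"

text \<open>The reversal is taken with respect to the actual degree of the polynomial; it is only
  applied to polynomials of index \<open>n\<close> that are monic of degree exactly \<open>n\<close>.\<close>

definition reversed_poly :: "complex poly \<Rightarrow> complex poly" where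
  "reversed_poly p = reflect_poly (map_poly cnj p)"

lemma poly_reversed_poly:
  assumes "z \<noteq> 0"
  shows "poly (reversed_poly p) z = z ^ degree p * cnj (poly p (1 / cnj z))"
proof -
  have "degree (map_poly cnj p) = degree p"
    by (rule degree_map_poly) simp
  moreover have "poly (map_poly cnj p) (inverse z) = cnj (poly p (1 / cnj z))"
    using poly_cnj[of p "1 / cnj z"] by (simp only: complex_cnj_divide complex_cnj_cnj complex_cnj_one inverse_eq_divide)
  ultimately show ?thesis
    using poly_reflect_poly_nz[OF assms, of "map_poly cnj p"]
    by (simp only: reversed_poly_def)
qed

primrec assoc_opuc :: "(nat \<Rightarrow> complex) \<Rightarrow> nat \<Rightarrow> nat \<Rightarrow> complex poly" where
  "assoc_opuc \<alpha> k 0 = 1"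
| "assoc_opuc \<alpha> k (Suc n) =
     [:0, 1:] * assoc_opuc \<alpha> k n
     - smult (cnj (\<alpha> (n + k))) (reversed_poly (assoc_opuc \<alpha> k n))"

text \<open>With \<open>z = e\<^sup>i\<^sup>\<theta>\<close> on the unit circle, \<open>cnj\<close> is the map sending
  \<open>\<theta>\<close> to \<open>-\<theta>\<close> and \<open>Re\<close> is the map sending \<open>z\<close> to \<open>cos \<theta>\<close>.\<close>

definition is_szego_transform :: "real measure \<Rightarrow> complex measure \<Rightarrow> bool" where
  "is_szego_transform \<nu> \<sigma> \<longleftrightarrow>
     prob_on (sphere 0 1) \<sigma> \<and> distr \<sigma> borel cnj = \<sigma> \<and> distr \<sigma> borel Re = \<nu>"

end

theory Submission imports Defs begin

text \<open>Everything follows from the Geronimus relations, with \<open>\<alpha> (- 1) = - 1\<close>,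
  \<open>2 b (n + 1) = (1 - \<alpha> (2n - 1)) \<alpha> (2n) - (1 + \<alpha> (2n - 1)) \<alpha> (2n - 2)\<close> and
  \<open>4 d (n + 1) = (1 - \<alpha> (2n - 1)) (1 - \<alpha> (2n)\<^sup>2) (1 + \<alpha> (2n + 1))\<close>:
  passing to the associated polynomials shifts \<open>\<alpha>\<close> by \<open>k\<close>, and the claimed formulas become
  algebraic identities in the \<open>\<alpha>\<close>'s.

  To obtain the relations, let \<open>Q n\<close> be the monic real polynomials generated by the three-term
  recurrence with these coefficients. Two double steps of the Szego recurrence
  show that on the unit circle
  \<open>(2z)^n (1 - \<alpha> (2n - 1)) Q n (Re z) = \<Phi> (2n) (z) + \<Phi>* (2n) (z)\<close>. The right-hand side is orthogonal
  to \<open>z, \<dots>, z^(2n - 1)\<close>, so \<open>Q n\<close> is orthogonal to all polynomials of lower degree and is therefore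
  the orthogonal polynomial of the measure on the interval.\<close>

section \<open>Probability measures carried by compact sets\<close>

lemma AE_prob_on: "prob_on S M \<Longrightarrow> AE x in M. x \<in> S"
  by (simp add: prob_on_def)

lemma borel_measurable_prob_on:
  fixes f :: "'a::topological_space \<Rightarrow> 'b::topological_space"
  assumes "prob_on S M" "continuous_on UNIV f"
  shows "f \<in> borel_measurable M"
proof -
  have "sets M = sets borel"
    using assms(1) by (simp add: prob_on_def)
  then have "borel_measurable M = (borel_measurable borel :: ('a \<Rightarrow> 'b) set)"
    by (rule measurable_cong_sets) simp
  then show ?thesis
    using borel_measurable_continuous_onI[OF assms(2)] by simp
qed

lemma integrable_prob_on_compact:
  fixes f :: "'a::topological_space \<Rightarrow> 'b::{banach, second_countable_topology}"
  assumes M: "prob_on S M" and S: "compact S" and f: "continuous_on UNIV f"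
  shows "integrable M f"
proof -
  interpret prob_space M
    using M by (simp add: prob_on_def)
  have "bounded (f ` S)"
    by (intro compact_imp_bounded compact_continuous_image continuous_on_subset[OF f] S) auto
  then obtain B where "\<forall>y\<in>f ` S. norm y \<le> B"
    by (auto simp: bounded_iff)
  then have "AE x in M. norm (f x) \<le> B"
    using AE_prob_on[OF M] by (auto elim: eventually_mono)
  then show ?thesis
    by (rule integrable_const_bound) (rule borel_measurable_prob_on[OF M f])
qed

text \<open>A vanishing integral puts almost all mass on the roots of \<open>p\<close>. A nonzero
  polynomial has finitely many of them, which non-triviality forbids. This definiteness is behind
  every uniqueness argument below, on the circle and on the interval.\<close>

lemma poly_eq_0_if_integral_norm_square_eq_0:
  fixes p :: "'a::real_normed_field poly"
  assumes M: "nontrivial_prob_on S M" and S: "compact S"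
    and int: "(\<integral>x. (norm (poly p x))\<^sup>2 \<partial>M) = 0"
  shows "p = 0"
proof (rule ccontr)
  assume "p \<noteq> 0"
  have M': "prob_on S M"
    using M by (simp add: nontrivial_prob_on_def)
  have "integrable M (\<lambda>x. (norm (poly p x))\<^sup>2)"
    by (intro integrable_prob_on_compact[OF M' S] continuous_intros)
  then have "AE x in M. (norm (poly p x))\<^sup>2 = 0"
    using int by (subst (asm) integral_nonneg_eq_0_iff_AE) auto
  then have "AE x in M. x \<in> {x. poly p x = 0}"
    by simp
  then show False
    using M poly_roots_finite[OF \<open>p \<noteq> 0\<close>] unfolding nontrivial_prob_on_def by blast
qed

section \<open>Monic polynomial bases and three-term recurrences\<close>

text \<open>Subtracting the multiple of \<open>\<Phi> (degree p)\<close> with the same leading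
  coefficient lowers the degree. The rule reduces orthogonality to all polynomials of lower degree
  to a check on a basis: the orthogonal family itself or the monomials.\<close>

lemma monic_basis_induct [consumes 3, case_names zero add smult basis]:
  fixes \<Phi> :: "nat \<Rightarrow> 'a::comm_ring_1 poly"
  assumes monic: "\<And>n. degree (\<Phi> n) = n" "\<And>n. coeff (\<Phi> n) n = 1"
    and deg: "degree p < n"
    and zero: "Z 0" and add: "\<And>p q. Z p \<Longrightarrow> Z q \<Longrightarrow> Z (p + q)"
    and smult: "\<And>c p. Z p \<Longrightarrow> Z (smult c p)"
    and basis: "\<And>j. j < n \<Longrightarrow> Z (\<Phi> j)"
  shows "Z p"
  using deg
proof (induction "degree p" arbitrary: p rule: less_induct)
  case less
  define q where "q = p - smult (lead_coeff p) (\<Phi> (degree p))"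
  have basis_p: "Z (smult (lead_coeff p) (\<Phi> (degree p)))"
    using less.prems by (intro smult basis)
  have "Z q"
  proof (cases "q = 0")
    case False
    have "degree q \<le> degree p"
      unfolding q_def using monic(1)[of "degree p"]
      by (intro degree_diff_le order.trans[OF degree_smult_le]) auto
    moreover have "coeff q (degree p) = 0"
      unfolding q_def using monic(2)[of "degree p"] by simp
    ultimately have "degree q < degree p"
      using False by (metis le_neq_implies_less leading_coeff_0_iff)
    then show ?thesis
      using less by auto
  qed (use zero in simp)
  then have "Z (q + smult (lead_coeff p) (\<Phi> (degree p)))"
    using basis_p by (rule add)
  then show ?case
    by (simp add: q_def)
qed

lemma degree_diff_monic_less:
  fixes p q :: "'a::comm_ring_1 poly"
  assumes "degree p = n" "degree q = n" "coeff p n = 1" "coeff q n = 1" "p \<noteq> q"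
  shows "degree (p - q) < n"
proof -
  have "degree (p - q) \<le> n"
    using assms by (intro degree_diff_le) auto
  moreover have "coeff (p - q) n = 0"
    using assms by auto
  ultimately show ?thesis
    using \<open>p \<noteq> q\<close> by (metis eq_iff_diff_eq_0 le_neq_implies_less leading_coeff_0_iff)
qed

text \<open>This is one step of a three-term recurrence, with \<open>q\<close> standing for the
  multiple of the earlier polynomial.\<close>

lemma monic_linear_mult_diff:
  fixes p q :: "'a::comm_ring_1 poly"
  assumes "degree p = n" "coeff p n = 1" "degree q \<le> n"
  shows "degree ([:- c, 1:] * p - q) = Suc n" "coeff ([:- c, 1:] * p - q) (Suc n) = 1"
proof -
  show coeff: "coeff ([:- c, 1:] * p - q) (Suc n) = 1"
    using assms by (simp add: coeff_eq_0)
  have "degree ([:- c, 1:] * p) \<le> Suc n"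
    using degree_mult_le[of "[:- c, 1:]" p] assms(1) by (auto split: if_splits)
  then have "degree ([:- c, 1:] * p - q) \<le> Suc n"
    using assms(3) by (intro degree_diff_le) auto
  moreover have "Suc n \<le> degree ([:- c, 1:] * p - q)"
    by (rule le_degree) (simp only: coeff, simp)
  ultimately show "degree ([:- c, 1:] * p - q) = Suc n"
    by simp
qed

text \<open>With \<open>g 0 = - 1\<close> and \<open>g (Suc n) = \<alpha> n\<close> these are the coefficients \<open>b (n + 1)\<close> and
  \<open>d (n + 1)\<close>. At \<open>n = 0\<close> the truncated index \<open>2 * n - 1\<close> is harmless, because its factor
  \<open>1 + g 0\<close> is zero.\<close>

definition geronimus_b :: "(nat \<Rightarrow> real) \<Rightarrow> nat \<Rightarrow> real" where
  "geronimus_b g n = ((1 - g (2 * n)) * g (2 * n + 1) - (1 + g (2 * n)) * g (2 * n - 1)) / 2"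

definition geronimus_d :: "(nat \<Rightarrow> real) \<Rightarrow> nat \<Rightarrow> real" where
  "geronimus_d g n = (1 - g (2 * n)) * (1 - (g (2 * n + 1))\<^sup>2) * (1 + g (2 * n + 2)) / 4"

fun geronimus_poly :: "(nat \<Rightarrow> real) \<Rightarrow> nat \<Rightarrow> real poly" where
  "geronimus_poly g 0 = 1"
| "geronimus_poly g (Suc 0) = [:- geronimus_b g 0, 1:]"
| "geronimus_poly g (Suc (Suc n)) =
     [:- geronimus_b g (Suc n), 1:] * geronimus_poly g (Suc n)
     - smult (geronimus_d g n) (geronimus_poly g n)"

lemma monic_geronimus_poly:
  "degree (geronimus_poly g n) = n" "coeff (geronimus_poly g n) n = 1"
proof (induction n rule: induct_nat_012)
  case (ge2 n)
  {
    case 1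
    show ?case
      unfolding geronimus_poly.simps
      using ge2 by (intro monic_linear_mult_diff order.trans[OF degree_smult_le]) auto
  next
    case 2
    show ?case
      unfolding geronimus_poly.simps
      using ge2 by (intro monic_linear_mult_diff order.trans[OF degree_smult_le]) auto
  }
qed simp_all

section \<open>Orthogonal polynomials on the unit circle and the Szego recurrence\<close>

locale opuc =
  fixes \<sigma> :: "complex measure" and \<Phi> :: "nat \<Rightarrow> complex poly"
  assumes nontriv: "nontrivial_prob_on (sphere 0 1) \<sigma>"
    and opuc: "monic_opuc \<sigma> \<Phi>"
begin

abbreviation \<alpha> :: "nat \<Rightarrow> complex" where
  "\<alpha> \<equiv> verblunsky \<Phi>"

abbreviation rev_Phi :: "nat \<Rightarrow> complex poly" where
  "rev_Phi n \<equiv> reversed_poly (\<Phi> n)"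

definition ip :: "complex poly \<Rightarrow> complex poly \<Rightarrow> complex" where
  "ip p q = (\<integral>z. poly p z * cnj (poly q z) \<partial>\<sigma>)"

lemma prob_on: "prob_on (sphere 0 1) \<sigma>"
  using nontriv by (simp add: nontrivial_prob_on_def)

lemma AE_circle: "AE z in \<sigma>. cmod z = 1"
  using AE_prob_on[OF prob_on] by simp

lemma integrable_continuous:
  fixes f :: "complex \<Rightarrow> 'b::{banach, second_countable_topology}"
  shows "continuous_on UNIV f \<Longrightarrow> integrable \<sigma> f"
  by (rule integrable_prob_on_compact[OF prob_on]) auto

lemma integral_cong_circle:
  fixes f g :: "complex \<Rightarrow> 'b::{banach, second_countable_topology}"
  assumes "continuous_on UNIV f" "continuous_on UNIV g" "\<And>z. cmod z = 1 \<Longrightarrow> f z = g z"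
  shows "integral\<^sup>L \<sigma> f = integral\<^sup>L \<sigma> g"
  using AE_circle assms
  by (intro integral_cong_AE borel_measurable_prob_on[OF prob_on]) (auto elim: eventually_mono)

lemma integrable_ip: "integrable \<sigma> (\<lambda>z. poly p z * cnj (poly q z))"
  by (intro integrable_continuous continuous_intros)

lemma ip_add_left: "ip (p + q) r = ip p r + ip q r"
  using integrable_ip by (simp add: ip_def distrib_right)

lemma ip_smult_left: "ip (smult c p) r = c * ip p r"
  by (simp add: ip_def mult.assoc)

lemma ip_commute: "ip q p = cnj (ip p q)"
  unfolding ip_def Bochner_Integration.integral_cnj[symmetric] by (simp add: mult.commute)

lemma ip_diff_left: "ip (p - q) r = ip p r - ip q r"
  using integrable_ip by (simp add: ip_def left_diff_distrib)

lemma ip_add_right: "ip r (p + q) = ip r p + ip r q"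
  using ip_add_left ip_commute by (metis complex_cnj_add)

lemma ip_smult_right: "ip r (smult c p) = cnj c * ip r p"
  using ip_smult_left ip_commute by (metis complex_cnj_mult)

lemma ip_0_right: "ip r 0 = 0"
  by (simp add: ip_def)

lemma ip_self: "ip p p = of_real (\<integral>z. (cmod (poly p z))\<^sup>2 \<partial>\<sigma>)"
  unfolding ip_def integral_complex_of_real[symmetric] complex_norm_square ..

lemma ip_self_eq_0: "ip p p = 0 \<Longrightarrow> p = 0"
  using poly_eq_0_if_integral_norm_square_eq_0[OF nontriv] by (simp add: ip_self)

lemma monic: "degree (\<Phi> n) = n" "coeff (\<Phi> n) n = 1"
  using opuc by (simp_all add: monic_opuc_def) metis

lemma ip_Phi:
  assumes "degree q < n"
  shows "ip (\<Phi> n) q = 0"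
  using monic assms
proof (induction rule: monic_basis_induct)
  case (basis j)
  then show ?case
    using opuc by (simp add: monic_opuc_def ip_def)
qed (simp_all add: ip_0_right ip_add_right ip_smult_right)

text \<open>The difference from \<open>\<Phi> n\<close> has degree below \<open>n\<close>, so it is
  orthogonal to both polynomials and hence to itself.\<close>

lemma Phi_unique:
  assumes "degree p = n" "coeff p n = 1" "\<And>q. degree q < n \<Longrightarrow> ip p q = 0"
  shows "p = \<Phi> n"
proof (rule ccontr)
  assume "p \<noteq> \<Phi> n"
  then have "degree (p - \<Phi> n) < n"
    using assms monic by (intro degree_diff_monic_less) auto
  then have "ip (p - \<Phi> n) (p - \<Phi> n) = 0"
    using assms(3) ip_Phi by (simp add: ip_diff_left)
  then show False
    using \<open>p \<noteq> \<Phi> n\<close> ip_self_eq_0 by force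
qed

lemma poly_rev_Phi: "cmod z = 1 \<Longrightarrow> poly (rev_Phi n) z = z ^ n * cnj (poly (\<Phi> n) z)"
proof -
  assume z: "cmod z = 1"
  then have "z \<noteq> 0"
    by auto
  moreover have "1 / cnj z = z"
    using z complex_norm_square[of z] \<open>z \<noteq> 0\<close> by (simp add: field_simps)
  ultimately show ?thesis
    using monic by (simp add: poly_reversed_poly)
qed

lemma rev_Phi_0: "coeff (rev_Phi n) 0 = 1"
proof -
  have "degree (map_poly cnj (\<Phi> n)) = n"
    using monic by (subst degree_map_poly) auto
  then show ?thesis
    using monic by (simp add: reversed_poly_def coeff_map_poly)
qed

lemma degree_rev_Phi: "degree (rev_Phi n) \<le> n"
proof -
  have "degree (map_poly cnj (\<Phi> n)) = n"
    using monic by (subst degree_map_poly) auto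
  then show ?thesis
    unfolding reversed_poly_def using degree_reflect_poly_le by metis
qed

lemma unit_cnj: "cmod z = 1 \<Longrightarrow> z * cnj z = 1"
  using complex_norm_square[of z] by simp

lemma unit_cnj_power: "cmod z = 1 \<Longrightarrow> z ^ n * cnj z ^ n = 1"
  using unit_cnj by (metis power_mult_distrib power_one)

text \<open>Multiplication by \<open>z\<close> preserves the inner product because
  \<open>z * cnj z = 1\<close> on the circle.\<close>

lemma ip_pCons: "ip (pCons 0 p) (pCons 0 q) = ip p q"
  unfolding ip_def
  by (rule integral_cong_circle) (auto intro!: continuous_intros simp: algebra_simps dest!: unit_cnj)

text \<open>On the circle, pairing the reversed polynomial with \<open>z^(j+1)\<close> is the
  conjugate of pairing \<open>\<Phi> n\<close> with \<open>z^(n-j-1)\<close>. For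
  \<open>j < n\<close> the latter has degree below \<open>n\<close>, so the pairing
  vanishes.\<close>

lemma ip_rev_Phi_pCons:
  assumes "degree q < n"
  shows "ip (rev_Phi n) (pCons 0 q) = 0"
proof -
  have monic_monom: "degree (monom (1::complex) j) = j" "coeff (monom (1::complex) j) j = 1" for j
    by (simp_all add: degree_monom_eq)
  show ?thesis
    using monic_monom assms
  proof (induction rule: monic_basis_induct)
    case (add p q)
    then show ?case
      using ip_add_right[of _ "pCons 0 p" "pCons 0 q"] by simp
  next
    case (smult c p)
    then show ?case
      using ip_smult_right[of _ c "pCons 0 p"] by simp
  next
    case (basis j)
    have "ip (rev_Phi n) (pCons 0 (monom 1 j)) = cnj (ip (\<Phi> n) (monom 1 (n - Suc j)))"
      unfolding ip_def Bochner_Integration.integral_cnj[symmetric]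
    proof (rule integral_cong_circle)
      fix z :: complex
      assume z: "cmod z = 1"
      have "z ^ n = z ^ (n - Suc j) * z ^ Suc j"
        using basis by (subst power_add[symmetric]) simp
      moreover have "z ^ Suc j * cnj z ^ Suc j = 1"
        using z by (rule unit_cnj_power)
      ultimately have "z ^ n * cnj z ^ Suc j = z ^ (n - Suc j)"
        by (simp only: mult.assoc mult_1_right)
      then show "poly (rev_Phi n) z * cnj (poly (pCons 0 (monom 1 j)) z)
          = cnj (poly (\<Phi> n) z * cnj (poly (monom 1 (n - Suc j)) z))"
        using z by (simp add: poly_rev_Phi poly_monom algebra_simps)
    qed (intro continuous_intros)+
    also have "\<dots> = 0"
      using basis by (simp add: ip_Phi degree_monom_eq)
    finally show ?case .
  qed (simp add: ip_0_right)
qed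

text \<open>The difference of both sides vanishes at 0 and is orthogonal to \<open>z, \<dots>, z^n\<close>,
  hence to itself.\<close>

lemma szego_recurrence: "\<Phi> (Suc n) = pCons 0 (\<Phi> n) - smult (cnj (\<alpha> n)) (rev_Phi n)"
proof -
  define h where "h = \<Phi> (Suc n) - pCons 0 (\<Phi> n)"
  define q where "q = h + smult (cnj (\<alpha> n)) (rev_Phi n)"
  have "degree h \<le> n"
  proof (cases "h = 0")
    case False
    have "\<Phi> n \<noteq> 0"
      using monic[of n] by auto
    then have "degree h < Suc n"
      unfolding h_def using False monic[of n] monic[of "Suc n"]
      by (intro degree_diff_monic_less) (auto simp: h_def)
    then show ?thesis
      by simp
  qed simp
  then have deg: "degree q \<le> n"
    unfolding q_def using degree_rev_Phi
    by (intro degree_add_le order.trans[OF degree_smult_le])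
  have "coeff q 0 = 0"
    by (simp add: q_def h_def rev_Phi_0 verblunsky_def poly_0_coeff_0)
  then obtain s where s: "q = pCons 0 s"
    by (cases q) auto
  have "ip q q = 0"
  proof (cases "s = 0")
    case False
    then have "degree s < n"
      using deg s by simp
    then have "ip (\<Phi> (Suc n)) q = 0" "ip (pCons 0 (\<Phi> n)) q = 0" "ip (rev_Phi n) q = 0"
      using deg s by (simp_all add: ip_Phi ip_pCons ip_rev_Phi_pCons)
    then show ?thesis
      unfolding q_def h_def by (simp add: ip_add_left ip_diff_left ip_smult_left)
  qed (simp add: s ip_0_right)
  then have "q = 0"
    by (rule ip_self_eq_0)
  then show ?thesis
    by (simp add: q_def h_def algebra_simps eq_neg_iff_add_eq_0)
qed

text \<open>In the recurrence solved for \<open>z \<Phi> n\<close>, the two summands are orthogonal.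
  Multiplication by \<open>z\<close> and reversal both preserve the norm, so Pythagoras gives
  \<open>N n = N (n+1) + |\<alpha> n|^2 N n\<close>, where all squared norms are positive.\<close>

lemma norm_verblunsky_less_1: "cmod (\<alpha> n) < 1"
proof -
  define N where "N n = (\<integral>z. (cmod (poly (\<Phi> n) z))\<^sup>2 \<partial>\<sigma>)" for n
  have ip_N: "ip (\<Phi> n) (\<Phi> n) = of_real (N n)" for n
    by (simp add: ip_self N_def)
  have rev_N: "ip (rev_Phi n) (rev_Phi n) = of_real (N n)"
    unfolding ip_N[symmetric] ip_def
  proof (rule integral_cong_circle)
    fix z :: complex
    assume z: "cmod z = 1"
    have "z ^ n * cnj z ^ n = 1"
      using z by (rule unit_cnj_power)
    then have "(z ^ n * cnj z ^ n) * (cnj (poly (\<Phi> n) z) * poly (\<Phi> n) z)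
        = cnj (poly (\<Phi> n) z) * poly (\<Phi> n) z"
      by simp
    then show "poly (rev_Phi n) z * cnj (poly (rev_Phi n) z) = poly (\<Phi> n) z * cnj (poly (\<Phi> n) z)"
      using z by (simp add: poly_rev_Phi mult_ac)
  qed (intro continuous_intros)+
  have pos: "0 < N n" for n
  proof -
    have "\<Phi> n \<noteq> 0"
      using monic[of n] by auto
    then have "N n \<noteq> 0"
      using ip_self_eq_0[of "\<Phi> n"] ip_N by auto
    moreover have "0 \<le> N n"
      by (simp add: N_def)
    ultimately show ?thesis
      by simp
  qed
  have eq: "pCons 0 (\<Phi> n) = \<Phi> (Suc n) + smult (cnj (\<alpha> n)) (rev_Phi n)"
    by (simp add: szego_recurrence)
  have orth: "ip (\<Phi> (Suc n)) (rev_Phi n) = 0" "ip (rev_Phi n) (\<Phi> (Suc n)) = 0"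
    using ip_Phi degree_rev_Phi[of n] ip_commute[of "rev_Phi n" "\<Phi> (Suc n)"] by auto
  have "of_real (N n) = ip (pCons 0 (\<Phi> n)) (pCons 0 (\<Phi> n))"
    by (simp add: ip_pCons ip_N)
  also have "\<dots> = of_real (N (Suc n)) + cnj (\<alpha> n) * \<alpha> n * of_real (N n)"
    unfolding eq by (simp add: ip_add_left ip_add_right ip_smult_left ip_smult_right orth ip_N rev_N)
  also have "\<dots> = of_real (N (Suc n) + (cmod (\<alpha> n))\<^sup>2 * N n)"
    using complex_norm_square[of "\<alpha> n"] by (simp add: mult.commute)
  finally have "N n = N (Suc n) + (cmod (\<alpha> n))\<^sup>2 * N n"
    by (simp only: of_real_eq_iff)
  then have "(cmod (\<alpha> n))\<^sup>2 * N n < 1 * N n"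
    using pos[of "Suc n"] by linarith
  then have "(cmod (\<alpha> n))\<^sup>2 < 1"
    using pos[of n] by (simp only: mult_less_cancel_right_pos)
  then show ?thesis
    by (simp add: power_less_one_iff abs_square_less_1)
qed

end

section \<open>Measures symmetric under conjugation: real Verblunsky coefficients\<close>

locale symmetric_opuc = opuc +
  assumes distr_cnj: "distr \<sigma> borel cnj = \<sigma>"
begin

lemma integral_cnj_invariant:
  fixes f :: "complex \<Rightarrow> complex"
  assumes "continuous_on UNIV f"
  shows "(\<integral>z. f (cnj z) \<partial>\<sigma>) = (\<integral>z. f z \<partial>\<sigma>)"
proof -
  have "(\<integral>z. f z \<partial>distr \<sigma> borel cnj) = (\<integral>z. f (cnj z) \<partial>\<sigma>)"
    using borel_measurable_prob_on[OF prob_on, of cnj] assms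
    by (intro integral_distr borel_measurable_continuous_onI) (auto intro: continuous_intros)
  then show ?thesis
    by (simp add: distr_cnj)
qed

lemma cnj_poly: "cnj (poly p (cnj z)) = poly (map_poly cnj p) z"
  using poly_cnj[of p "cnj z"] by simp

text \<open>By symmetry of the measure, conjugating the coefficients of \<open>\<Phi> n\<close>
  yields again a monic polynomial orthogonal to all lower degrees; uniqueness then applies.\<close>

lemma Phi_real: "map_poly cnj (\<Phi> n) = \<Phi> n"
proof (rule Phi_unique)
  show deg: "degree (map_poly cnj (\<Phi> n)) = n"
    using monic by (subst degree_map_poly) auto
  show "coeff (map_poly cnj (\<Phi> n)) n = 1"
    using monic by (simp add: coeff_map_poly)
  fix q :: "complex poly"
  assume "degree q < n"
  have "ip (map_poly cnj (\<Phi> n)) q = (\<integral>z. cnj (poly (\<Phi> n) (cnj z)) * cnj (poly q z) \<partial>\<sigma>)"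
    by (simp only: ip_def cnj_poly)
  also have "\<dots> = (\<integral>z. cnj (poly (\<Phi> n) z) * cnj (poly q (cnj z)) \<partial>\<sigma>)"
    by (subst integral_cnj_invariant[symmetric]) (auto intro!: continuous_intros)
  also have "\<dots> = cnj (ip (\<Phi> n) (map_poly cnj q))"
    by (simp add: ip_def cnj_poly[symmetric] flip: Bochner_Integration.integral_cnj)
  also have "\<dots> = 0"
    using \<open>degree q < n\<close> by (subst ip_Phi) (simp_all add: degree_map_poly)
  finally show "ip (map_poly cnj (\<Phi> n)) q = 0" .
qed

lemma verblunsky_real: "cnj (\<alpha> n) = \<alpha> n"
proof -
  have "cnj (poly (\<Phi> (n + 1)) 0) = poly (\<Phi> (n + 1)) 0"
    using cnj_poly[of "\<Phi> (n + 1)" 0] by (simp only: Phi_real complex_cnj_zero)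
  then show ?thesis
    by (simp add: verblunsky_def)
qed

text \<open>The shift by one makes room for the convention that the coefficient of index -1 is -1.
  Taking the real part loses nothing, as \<open>verblunsky_real\<close> shows.\<close>

definition shifted_verblunsky :: "nat \<Rightarrow> real" where
  "shifted_verblunsky n = (case n of 0 \<Rightarrow> - 1 | Suc j \<Rightarrow> Re (\<alpha> j))"

lemma of_real_shifted_verblunsky: "of_real (shifted_verblunsky (Suc n)) = \<alpha> n"
  using verblunsky_real[of n] by (simp add: shifted_verblunsky_def complex_eq_iff)

text \<open>Needed to cancel the factors \<open>1 - \<alpha> (2n - 1)\<close>. The value -1 does
  occur, at index 0.\<close>

lemma shifted_verblunsky_neq_1: "shifted_verblunsky n \<noteq> 1"
proof (cases n)
  case (Suc j)
  have "\<bar>Re (\<alpha> j)\<bar> < 1"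
    using norm_verblunsky_less_1[of j] abs_Re_le_cmod[of "\<alpha> j"] by linarith
  then show ?thesis
    by (auto simp: Suc shifted_verblunsky_def)
qed (simp add: shifted_verblunsky_def)

text \<open>The second equation is the conjugate of the first multiplied by \<open>z^(n+1)\<close>;
  the coefficient survives conjugation because it is real.\<close>

lemma szego_step:
  assumes "cmod z = 1"
  shows "poly (\<Phi> (Suc n)) z
           = z * poly (\<Phi> n) z - of_real (shifted_verblunsky (Suc n)) * poly (rev_Phi n) z"
    and "poly (rev_Phi (Suc n)) z
           = poly (rev_Phi n) z - of_real (shifted_verblunsky (Suc n)) * z * poly (\<Phi> n) z"
proof -
  show 1: "poly (\<Phi> (Suc n)) z
      = z * poly (\<Phi> n) z - of_real (shifted_verblunsky (Suc n)) * poly (rev_Phi n) z" for n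
    by (simp add: szego_recurrence[of n] verblunsky_real of_real_shifted_verblunsky)
  have z1: "z ^ n * cnj z ^ n = 1"
    using assms by (rule unit_cnj_power)
  have "poly (rev_Phi (Suc n)) z
      = (z * cnj z) * (z ^ n * cnj (poly (\<Phi> n) z))
        - of_real (shifted_verblunsky (Suc n)) * z * (z ^ n * cnj z ^ n) * poly (\<Phi> n) z"
    by (simp add: poly_rev_Phi[OF assms] 1 algebra_simps)
  then show "poly (rev_Phi (Suc n)) z
      = poly (rev_Phi n) z - of_real (shifted_verblunsky (Suc n)) * z * poly (\<Phi> n) z"
    by (simp add: z1 unit_cnj[OF assms] poly_rev_Phi[OF assms])
qed

abbreviation Q :: "nat \<Rightarrow> real poly" where
  "Q \<equiv> geronimus_poly shifted_verblunsky"

lemma Phi_0: "\<Phi> 0 = 1"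
  using monic[of 0] by (metis degree_eq_zeroE coeff_pCons_0 one_pCons)

lemma two_z_Re:
  assumes "cmod z = 1"
  shows "2 * z * of_real (Re z) = z\<^sup>2 + 1"
proof -
  have "2 * z * of_real (Re z) = z * (z + cnj z)"
    by (simp add: complex_add_cnj)
  then show ?thesis
    using unit_cnj[OF assms] by (simp add: distrib_left power2_eq_square)
qed

lemma poly_Q_Re:
  assumes z: "cmod z = 1"
  shows "(2 * z) ^ n * (1 - of_real (shifted_verblunsky (2 * n))) * of_real (poly (Q n) (Re z))
    = poly (\<Phi> (2 * n)) z + poly (rev_Phi (2 * n)) z"
proof (induction n rule: induct_nat_012)
  case 0
  show ?case
    \<comment> \<open>Both sides equal 2: the prefactor is \<open>1 - (- 1)\<close>.\<close>
    using Phi_0 poly_rev_Phi[OF z, of 0] by (simp add: shifted_verblunsky_def)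
next
  case 1
  have F0: "poly (\<Phi> 0) z = 1" "poly (rev_Phi 0) z = 1"
    using Phi_0 poly_rev_Phi[OF z, of 0] by simp_all
  define a1 a2 where "a1 = complex_of_real (shifted_verblunsky 1)"
    and "a2 = complex_of_real (shifted_verblunsky 2)"
  have "(2 * z) ^ 1 * (1 - a2) * of_real (poly (Q 1) (Re z))
      = (1 - a2) * (2 * z * of_real (Re z) - 2 * z * a1)"
    by (simp add: geronimus_b_def a1_def shifted_verblunsky_def algebra_simps)
  also have "\<dots> = (1 - a2) * (z * (z - a1) + (1 - a1 * z))"
    unfolding two_z_Re[OF z] by (simp add: power2_eq_square algebra_simps)
  also have "\<dots> = poly (\<Phi> 2) z + poly (rev_Phi 2) z"
    by (simp add: numeral_2_eq_2 szego_step[OF z] F0 a1_def a2_def algebra_simps)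
  finally show ?case
    by (simp add: a2_def)
next
  case (ge2 n)
  define g where "g j = complex_of_real (shifted_verblunsky j)" for j
  define r0 r1 where "r0 = complex_of_real (poly (Q n) (Re z))"
    and "r1 = complex_of_real (poly (Q (Suc n)) (Re z))"
  define F G where "F = poly (\<Phi> (2 * n)) z" and "G = poly (rev_Phi (2 * n)) z"
  define a1 b1 a2 b2 a3 where "a1 = g (2 * n)" and "b1 = g (Suc (2 * n))"
    and "a2 = g (Suc (Suc (2 * n)))" and "b2 = g (Suc (Suc (Suc (2 * n))))"
    and "a3 = g (Suc (Suc (Suc (Suc (2 * n)))))"
  \<comment> \<open>\<open>S\<close> is \<open>z\<close> times the value of
    \<open>\<Phi> (2n+1)\<close> plus that of its reversal. One more Szego step turns it into
    \<open>F2 + G2 = (1 - a2) * S\<close>, so cancelling \<open>1 - a2\<close> leaves a formula for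
    \<open>r1\<close> alone.\<close>
  define S where "S = z * (z * F - b1 * G) + (G - b1 * z * F)"
  define F2 G2 where "F2 = z * (z * F - b1 * G) - a2 * (G - b1 * z * F)"
    and "G2 = (G - b1 * z * F) - a2 * z * (z * F - b1 * G)"
  have F2: "poly (\<Phi> (Suc (Suc (2 * n)))) z = F2"
    and G2: "poly (rev_Phi (Suc (Suc (2 * n)))) z = G2"
    by (simp_all add: szego_step[OF z] F2_def G2_def F_def G_def a2_def b1_def g_def mult.assoc)
  have ih0: "(2 * z) ^ n * (1 - a1) * r0 = F + G"
    using ge2(1) by (simp only: r0_def F_def G_def a1_def g_def)
  have "(2 * z) ^ Suc n * (1 - a2) * r1 = F2 + G2"
    using ge2(2) by (simp only: r1_def a2_def g_def mult_Suc_right add_2_eq_Suc F2 G2)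
  also have "F2 + G2 = (1 - a2) * S"
    by (simp add: F2_def G2_def S_def algebra_simps)
  finally have "(2 * z) ^ Suc n * (1 - a2) * r1 = (1 - a2) * S" .
  moreover have "1 - a2 \<noteq> 0"
    using shifted_verblunsky_neq_1[of "Suc (Suc (2 * n))"] by (simp add: a2_def g_def)
  ultimately have ih1: "(2 * z) ^ Suc n * r1 = S"
    by (simp add: mult_ac)
  \<comment> \<open>The power of \<open>2 * z\<close> absorbs the denominators 2 and 4 of the
    recurrence coefficients, and the factor \<open>1 - a1\<close> of \<open>geronimus_d\<close> is
    the one that \<open>ih0\<close> requires.\<close>
  have "(2 * z) ^ Suc (Suc n) * of_real (poly (Q (Suc (Suc n))) (Re z))
      = (2 * z * of_real (Re z) - z * ((1 - a2) * b2 - (1 + a2) * b1)) * ((2 * z) ^ Suc n * r1)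
        - z\<^sup>2 * ((1 - b1\<^sup>2) * (1 + a2)) * ((2 * z) ^ n * (1 - a1) * r0)"
    by (simp add: r0_def r1_def a1_def a2_def b1_def b2_def g_def geronimus_b_def geronimus_d_def
        field_simps power2_eq_square)
  also have "\<dots> = (z\<^sup>2 + 1 - z * ((1 - a2) * b2 - (1 + a2) * b1)) * S
        - z\<^sup>2 * ((1 - b1\<^sup>2) * (1 + a2)) * (F + G)"
    by (simp only: ih0 ih1 two_z_Re[OF z])
  finally have "(2 * z) ^ Suc (Suc n) * (1 - a3) * of_real (poly (Q (Suc (Suc n))) (Re z))
      = (1 - a3) * ((z\<^sup>2 + 1 - z * ((1 - a2) * b2 - (1 + a2) * b1)) * S
        - z\<^sup>2 * ((1 - b1\<^sup>2) * (1 + a2)) * (F + G))"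
    by (simp add: mult_ac)
  also have "\<dots> = poly (\<Phi> (2 * Suc (Suc n))) z + poly (rev_Phi (2 * Suc (Suc n))) z"
  proof -
    have "poly (\<Phi> (2 * Suc (Suc n))) z + poly (rev_Phi (2 * Suc (Suc n))) z
        = (1 - a3) * (z * (z * F2 - b2 * G2) + (G2 - b2 * z * F2))"
      by (simp add: szego_step[OF z, of "Suc (Suc (Suc (2 * n)))"]
          szego_step[OF z, of "Suc (Suc (2 * n))"] F2 G2 flip: g_def b2_def a3_def)
        (simp add: algebra_simps)
    then show ?thesis
      unfolding F2_def G2_def S_def by (simp add: algebra_simps power2_eq_square)
  qed
  finally show ?case
    by (simp only: a3_def g_def mult_Suc_right add_2_eq_Suc)
qed

section \<open>Transfer to the interval and the Geronimus relations\<close>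

lemma integral_Re:
  fixes f :: "real \<Rightarrow> real"
  assumes "continuous_on UNIV f"
  shows "(\<integral>x. f x \<partial>distr \<sigma> borel Re) = (\<integral>z. f (Re z) \<partial>\<sigma>)"
  using assms
  by (intro integral_distr borel_measurable_continuous_onI borel_measurable_prob_on[OF prob_on]
      continuous_intros)

lemma Q_orthogonal:
  assumes "degree q < n"
  shows "(\<integral>x. poly (Q n) x * poly q x \<partial>distr \<sigma> borel Re) = 0"
proof -
  have int: "integrable \<sigma> (\<lambda>z. poly (Q n) (Re z) * poly p (Re z))" for p
    by (intro integrable_continuous continuous_intros)
  have monic_monom: "degree (monom (1::real) j) = j" "coeff (monom (1::real) j) j = 1" for j
    by (simp_all add: degree_monom_eq)
  have "(\<integral>z. poly (Q n) (Re z) * poly q (Re z) \<partial>\<sigma>) = 0"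
    using monic_monom assms
  proof (induction rule: monic_basis_induct)
    case (add p q)
    then show ?case
      using int by (simp add: distrib_left)
  next
    case (smult c p)
    then show ?case
      by (simp add: mult.left_commute)
  next
    case (basis j)
    \<comment> \<open>Since \<open>(z^2 + 1) / 2 = z * Re z\<close> on the circle,
      \<open>z * r\<close> equals \<open>z^n * (Re z)^j\<close> there. The power \<open>z^n\<close>
      cancels the one in \<open>poly_Q_Re\<close>.\<close>
    define r :: "complex poly" where "r = monom 1 (n - Suc j) * [:1/2, 0, 1/2:] ^ j"
    define c where "c = 2 ^ n * (1 - complex_of_real (shifted_verblunsky (2 * n)))"
    have c: "c \<noteq> 0"
      using shifted_verblunsky_neq_1[of "2 * n"] by (simp add: c_def)
    \<comment> \<open>The bound is \<open>n - 1 + j\<close>, at most \<open>2n - 2\<close>. Thus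
      \<open>z * r\<close> involves only \<open>z, ..., z^(2n-1)\<close>, to which both
      \<open>\<Phi> (2n)\<close> and its reversal are orthogonal.\<close>
    have "degree r \<le> (n - Suc j) + 2 * j"
      unfolding r_def
      by (intro order.trans[OF degree_mult_le] add_mono order.trans[OF degree_power_le])
        (auto simp: degree_monom_eq)
    then have "degree r + 1 < 2 * n"
      using basis by simp
    then have deg: "degree r < 2 * n" "degree (pCons 0 r) < 2 * n"
      using degree_pCons_le[of 0 r] by simp_all
    have "c * of_real (\<integral>z. poly (Q n) (Re z) * poly (monom 1 j) (Re z) \<partial>\<sigma>)
        = (\<integral>z. c * of_real (poly (Q n) (Re z) * poly (monom 1 j) (Re z)) \<partial>\<sigma>)"
      by (simp only: integral_mult_right_zero integral_complex_of_real)
    also have "\<dots> = ip (\<Phi> (2 * n) + rev_Phi (2 * n)) (pCons 0 r)"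
      unfolding ip_def
    proof (rule integral_cong_circle)
      fix z :: complex
      assume z: "cmod z = 1"
      have zn: "z ^ n * cnj z ^ n = 1"
        using z by (rule unit_cnj_power)
      have x: "z * of_real (Re z) = 1/2 + z * (z * (1/2))"
        using two_z_Re[OF z] by (simp add: power2_eq_square field_simps)
      have "z * poly r z = z * (z ^ (n - Suc j) * (1/2 + z * (z * (1/2))) ^ j)"
        by (simp add: r_def poly_monom)
      also have "\<dots> = z ^ (Suc (n - Suc j) + j) * of_real (Re z) ^ j"
        by (simp only: x[symmetric] power_mult_distrib power_add power_Suc mult_ac)
      also have "Suc (n - Suc j) + j = n"
        using basis by simp
      finally have r: "cnj (poly (pCons 0 r) z) = cnj z ^ n * of_real (Re z) ^ j"
        by simp
      have "poly (\<Phi> (2 * n) + rev_Phi (2 * n)) z * cnj (poly (pCons 0 r) z)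
          = (z ^ n * cnj z ^ n) * (c * of_real (poly (Q n) (Re z)) * of_real (Re z) ^ j)"
        unfolding r poly_add poly_Q_Re[OF z, symmetric] by (simp add: c_def power_mult_distrib mult_ac)
      then show "c * of_real (poly (Q n) (Re z) * poly (monom 1 j) (Re z))
          = poly (\<Phi> (2 * n) + rev_Phi (2 * n)) z * cnj (poly (pCons 0 r) z)"
        by (simp add: zn poly_monom)
    qed (intro continuous_intros)+
    also have "\<dots> = 0"
      using deg by (simp add: ip_add_left ip_Phi ip_rev_Phi_pCons)
    finally show ?case
      using c by simp
  qed simp
  then show ?thesis
    by (subst integral_Re) (auto intro!: continuous_intros)
qed

theorem geronimus_relations:
  assumes \<nu>: "distr \<sigma> borel Re = \<nu>" "nontrivial_prob_on {-1..1} \<nu>"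
    and bd: "recurrence_coeffs \<nu> b d"
  shows "b (Suc n) = geronimus_b shifted_verblunsky n"
    and "d (Suc n) = geronimus_d shifted_verblunsky n"
proof -
  obtain P where P: "monic_oprl \<nu> P"
    and rec: "\<And>n. P (n + 1) = [:- b (n + 1), 1:] * P n - (if n = 0 then 0 else smult (d n) (P (n - 1)))"
    using bd by (auto simp: recurrence_coeffs_def)
  have monic_P: "degree (P n) = n" "coeff (P n) n = 1" for n
    using P by (simp_all add: monic_oprl_def) metis
  have prob_\<nu>: "prob_on {-1..1} \<nu>"
    using \<nu>(2) by (simp add: nontrivial_prob_on_def)
  have int: "integrable \<nu> (\<lambda>x. poly p x * poly q x)" for p q
    by (rule integrable_prob_on_compact[OF prob_\<nu>]) (auto intro!: continuous_intros)
  have P_orth: "(\<integral>x. poly (P n) x * poly q x \<partial>\<nu>) = 0" if "degree q < n" for q n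
    using monic_P that
  proof (induction rule: monic_basis_induct)
    case (add p q)
    then show ?case
      using int by (simp add: distrib_left)
  next
    case (smult c p)
    then show ?case
      by (simp add: mult.left_commute)
  next
    case (basis j)
    then show ?case
      using P by (simp add: monic_oprl_def)
  qed simp
  have P_eq: "P n = Q n" for n
  proof (rule ccontr)
    assume neq: "P n \<noteq> Q n"
    define h where "h = P n - Q n"
    have "degree h < n"
      unfolding h_def using neq monic_P monic_geronimus_poly by (intro degree_diff_monic_less) auto
    \<comment> \<open>Having degree below \<open>n\<close>, \<open>h\<close> is orthogonal to both
      \<open>P n\<close> and \<open>Q n\<close>, hence to itself.\<close>
    then have "(\<integral>x. poly (P n) x * poly h x \<partial>\<nu>) - (\<integral>x. poly (Q n) x * poly h x \<partial>\<nu>) = 0"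
      using P_orth Q_orthogonal by (simp add: \<nu>(1))
    then have "(\<integral>x. poly (P n) x * poly h x - poly (Q n) x * poly h x \<partial>\<nu>) = 0"
      using int by simp
    then have "(\<integral>x. (norm (poly h x))\<^sup>2 \<partial>\<nu>) = 0"
      by (simp add: h_def power2_eq_square algebra_simps)
    then have "h = 0"
      by (intro poly_eq_0_if_integral_norm_square_eq_0[OF \<nu>(2)]) auto
    then show False
      using neq by (simp add: h_def)
  qed
  have b: "b (Suc n) = geronimus_b shifted_verblunsky n" for n
  proof -
    have "[:- b (Suc n), 1:] * Q n - (if n = 0 then 0 else smult (d n) (Q (n - 1))) = Q (Suc n)"
      using rec[of n] by (simp only: P_eq Suc_eq_plus1)
    \<comment> \<open>Both recurrences produce the same polynomial, and in degree \<open>n\<close>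
      the term with \<open>d\<close> does not contribute, so this coefficient determines
      \<open>b (Suc n)\<close>.\<close>
    then have "coeff ([:- b (Suc n), 1:] * Q n - (if n = 0 then 0 else smult (d n) (Q (n - 1)))) n
        = coeff (Q (Suc n)) n"
      by (simp only:)
    then show ?thesis
      by (cases n) (simp_all add: monic_geronimus_poly coeff_eq_0)
  qed
  then show "b (Suc n) = geronimus_b shifted_verblunsky n" .
  \<comment> \<open>With the linear factors now known to agree, the recurrences can differ only in
    their last terms.\<close>
  have "smult (d (Suc n)) (Q n) = smult (geronimus_d shifted_verblunsky n) (Q n)"
    using rec[of "Suc n"] b[of "Suc n"] by (simp add: P_eq)
  then have "coeff (smult (d (Suc n)) (Q n)) n = coeff (smult (geronimus_d shifted_verblunsky n) (Q n)) n"
    by simp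
  then show "d (Suc n) = geronimus_d shifted_verblunsky n"
    by (simp add: monic_geronimus_poly)
qed

end

section \<open>The Szego transformation and the associated polynomials\<close>

text \<open>A finite set of full measure on the circle would project under \<open>Re\<close> to a
  finite set of full measure for \<open>\<nu>\<close>.\<close>

lemma nontrivial_prob_on_circle:
  assumes "is_szego_transform \<nu> \<sigma>" "nontrivial_prob_on {-1..1} \<nu>"
  shows "nontrivial_prob_on (sphere 0 1) \<sigma>"
proof -
  have prob: "prob_on (sphere 0 1) \<sigma>" and distr: "distr \<sigma> borel Re = \<nu>"
    using assms(1) by (simp_all add: is_szego_transform_def)
  have Re: "Re \<in> borel_measurable \<sigma>"
    by (intro borel_measurable_prob_on[OF prob] continuous_intros)
  have False if F: "finite F" "AE z in \<sigma>. z \<in> F" for F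
  proof -
    have "AE z in \<sigma>. Re z \<in> Re ` F"
      using F(2) by (auto elim: eventually_mono)
    moreover have "{x \<in> space borel. x \<in> Re ` F} \<in> sets borel"
      using borel_closed[OF finite_imp_closed[OF finite_imageI[OF F(1), of Re]]] by simp
    ultimately have "AE x in \<nu>. x \<in> Re ` F"
      by (subst distr[symmetric], subst AE_distr_iff[OF Re]) auto
    then show False
      using assms(2) F(1) by (auto simp: nontrivial_prob_on_def)
  qed
  then show ?thesis
    using prob by (auto simp: nontrivial_prob_on_def)
qed

lemma symmetric_opuc_szego:
  assumes "is_szego_transform \<nu> \<sigma>" "nontrivial_prob_on {-1..1} \<nu>" "monic_opuc \<sigma> \<Phi>"
  shows "symmetric_opuc \<sigma> \<Phi>"
  using assms nontrivial_prob_on_circle[OF assms(1,2)]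
  by unfold_locales (simp_all add: is_szego_transform_def)

text \<open>The reversal of a monic polynomial has constant term 1, so at 0 the defining recurrence
  leaves only \<open>- cnj (\<alpha> (n + k))\<close>.\<close>

lemma verblunsky_assoc_opuc:
  assumes "monic_opuc \<sigma> (assoc_opuc \<alpha> k)"
  shows "verblunsky (assoc_opuc \<alpha> k) n = \<alpha> (n + k)"
proof -
  have deg: "degree (assoc_opuc \<alpha> k n) = n" and "lead_coeff (assoc_opuc \<alpha> k n) = 1"
    using assms unfolding monic_opuc_def by blast+
  moreover have "degree (map_poly cnj (assoc_opuc \<alpha> k n)) = degree (assoc_opuc \<alpha> k n)"
    by (rule degree_map_poly) simp
  ultimately have "poly (reversed_poly (assoc_opuc \<alpha> k n)) 0 = 1"
    by (simp add: reversed_poly_def coeff_map_poly)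
  then show ?thesis
    by (simp add: verblunsky_def)
qed

section \<open>Comparison of coefficients for odd and even shifts\<close>

theorem theorem5:
  fixes \<mu> \<mu>h :: "real measure" and \<sigma> \<sigma>k :: "complex measure"
    and b d bh dh :: "nat \<Rightarrow> real" and \<Phi> :: "nat \<Rightarrow> complex poly"
    and \<alpha> v :: "nat \<Rightarrow> complex" and k m :: nat
  assumes mu: "nontrivial_prob_on {-1..1} \<mu>"
    and mu_coeffs: "recurrence_coeffs \<mu> b d"
    and sigma: "is_szego_transform \<mu> \<sigma>"
    and Phi: "monic_opuc \<sigma> \<Phi>"
    and alpha: "\<And>n. \<alpha> n = verblunsky \<Phi> n"
    and k: "k \<ge> 1"
    and sigma_k: "nontrivial_prob_on (sphere 0 1) \<sigma>k"
    and Phi_k: "monic_opuc \<sigma>k (assoc_opuc \<alpha> k)"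
    and mu_hat: "nontrivial_prob_on {-1..1} \<mu>h"
    and sigma_k_szego: "is_szego_transform \<mu>h \<sigma>k"
    and mu_hat_coeffs: "recurrence_coeffs \<mu>h bh dh"
    and v: "\<And>n. n \<ge> 1 \<Longrightarrow> v n = 1/2 * (1 + \<alpha> n) * (1 - \<alpha> (n - 1))"
    and m: "m \<ge> 1"
  shows "(k = 2 * m - 1 \<longrightarrow>
            of_real (dh 1) = (1 + \<alpha> (2*m - 1)) / v (2*m + 1) * of_real (d (m + 1)) \<and>
            (\<forall>n\<ge>1. of_real (dh (n + 1)) =
                v (2*(n + m) - 1) / v (2*(n + m) + 1) * of_real (d (n + m + 1))) \<and>
            of_real (bh 1) = \<alpha> (2*m - 1) \<and>
            (\<forall>n\<ge>1. of_real (bh (n + 1)) =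
                of_real (b (n + m + 1)) + v (2*(n + m) - 2) - v (2*(n + m))))
       \<and> (k = 2 * m \<longrightarrow>
            (let l = 2 / (1 - \<alpha> (2*m - 1)) in
             of_real (dh 1) = l * of_real (d (m + 1)) \<and>
             (\<forall>n\<ge>1. dh (n + 1) = d (n + m + 1)) \<and>
             of_real (bh 1) = \<alpha> (2*m) \<and>
             (\<forall>n\<ge>1. bh (n + 1) = b (n + m + 1))))"
proof -
  interpret S: symmetric_opuc \<sigma> \<Phi>
    using sigma mu Phi by (rule symmetric_opuc_szego)
  interpret Sk: symmetric_opuc \<sigma>k "assoc_opuc \<alpha> k"
    using sigma_k_szego mu_hat Phi_k by (rule symmetric_opuc_szego)
  define a where "a n = Re (\<alpha> n)" for n
  have \<alpha>: "\<alpha> n = of_real (a n)" for n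
    using S.verblunsky_real[of n] by (simp add: a_def alpha complex_eq_iff)
  have a_less: "\<bar>a n\<bar> < 1" for n
    using S.norm_verblunsky_less_1[of n] by (simp add: alpha[symmetric] \<alpha>)
  have a_neq: "1 - a n \<noteq> 0" "1 + a n \<noteq> 0" for n
    using a_less[of n] by auto
  define w where "w n = (1 + a n) * (1 - a (n - 1)) / 2" for n
  have w: "v n = of_real (w n)" if "n \<ge> 1" for n
    using v[OF that] by (simp add: w_def \<alpha>)
  have g: "S.shifted_verblunsky (Suc n) = a n" for n
    by (simp add: S.shifted_verblunsky_def a_def alpha)
  have gk: "Sk.shifted_verblunsky (Suc n) = a (n + k)" for n
    by (simp add: Sk.shifted_verblunsky_def a_def verblunsky_assoc_opuc[OF Phi_k])
  have gk0: "Sk.shifted_verblunsky 0 = - 1"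
    by (simp add: Sk.shifted_verblunsky_def)
  have distr: "distr \<sigma> borel Re = \<mu>" "distr \<sigma>k borel Re = \<mu>h"
    using sigma sigma_k_szego by (simp_all add: is_szego_transform_def)
  note rel = S.geronimus_relations[OF distr(1) mu mu_coeffs]
  note relk = Sk.geronimus_relations[OF distr(2) mu_hat mu_hat_coeffs]
  have b: "b (N + 1) = ((1 - a (2 * N - 1)) * a (2 * N) - (1 + a (2 * N - 1)) * a (2 * N - 2)) / 2"
    and d: "d (N + 1) = (1 - a (2 * N - 1)) * (1 - (a (2 * N))\<^sup>2) * (1 + a (2 * N + 1)) / 4"
    if "N \<ge> 1" for N
  proof -
    have "S.shifted_verblunsky (2 * N) = a (2 * N - 1)"
      "S.shifted_verblunsky (2 * N - 1) = a (2 * N - 2)"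
      using g[of "2 * N - 1"] g[of "2 * N - 2"] that by (simp_all add: Suc_diff_Suc numeral_2_eq_2)
    then show "b (N + 1) = ((1 - a (2 * N - 1)) * a (2 * N) - (1 + a (2 * N - 1)) * a (2 * N - 2)) / 2"
      and "d (N + 1) = (1 - a (2 * N - 1)) * (1 - (a (2 * N))\<^sup>2) * (1 + a (2 * N + 1)) / 4"
      using rel[of N] g[of "2 * N"] g[of "2 * N + 1"] by (simp_all add: geronimus_b_def geronimus_d_def)
  qed
  have w_neq: "w n \<noteq> 0" for n
    using a_neq by (simp add: w_def)
  \<comment> \<open>\<open>w (2N+1)\<close> contains the factors \<open>1 + a (2N+1)\<close> and
    \<open>1 - a (2N)\<close> of \<open>d (N+1)\<close>. The free \<open>c\<close> serves both
    quotients in the odd case.\<close>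
  have d_w: "c / w (2 * N + 1) * d (N + 1) = c * ((1 - a (2 * N - 1)) * (1 + a (2 * N)) / 2)"
    if "N \<ge> 1" for c N
  proof -
    have d_eq: "d (N + 1) = w (2 * N + 1) * ((1 - a (2 * N - 1)) * (1 + a (2 * N)) / 2)"
      using d[OF that] by (simp add: w_def power2_eq_square algebra_simps)
    have "c / x * (x * y) = c * y" if "x \<noteq> 0" for x y :: real
      using that by simp
    from this[OF w_neq] show ?thesis
      unfolding d_eq .
  qed
  \<comment> \<open>Here the value -1 at index -1 enters in place of \<open>a (k - 1)\<close>, which
    is why the first coefficients follow a separate formula.\<close>
  have bh1: "bh 1 = a k" and dh1: "dh 1 = (1 - (a k)\<^sup>2) * (1 + a (k + 1)) / 2"
    using relk[of 0] gk[of 0] gk[of 1] gk0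
    by (simp_all add: geronimus_b_def geronimus_d_def numeral_2_eq_2 algebra_simps)
  have bh: "bh (n + 1) = ((1 - a (2 * n + k - 1)) * a (2 * n + k)
        - (1 + a (2 * n + k - 1)) * a (2 * n + k - 2)) / 2"
    and dh: "dh (n + 1) = (1 - a (2 * n + k - 1)) * (1 - (a (2 * n + k))\<^sup>2) * (1 + a (2 * n + k + 1)) / 4"
    if "n \<ge> 1" for n
  proof -
    have "Sk.shifted_verblunsky (2 * n) = a (2 * n + k - 1)"
      "Sk.shifted_verblunsky (2 * n - 1) = a (2 * n + k - 2)"
      using gk[of "2 * n - 1"] gk[of "2 * n - 2"] that by (simp_all add: Suc_diff_Suc numeral_2_eq_2)
    then show "bh (n + 1) = ((1 - a (2 * n + k - 1)) * a (2 * n + k)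
        - (1 + a (2 * n + k - 1)) * a (2 * n + k - 2)) / 2"
      and "dh (n + 1) = (1 - a (2 * n + k - 1)) * (1 - (a (2 * n + k))\<^sup>2) * (1 + a (2 * n + k + 1)) / 4"
      using relk[of n] gk[of "2 * n"] gk[of "2 * n + 1"] by (simp_all add: geronimus_b_def geronimus_d_def)
  qed
  show ?thesis
  proof (intro conjI impI allI, unfold Let_def, goal_cases)
    case 1
    have "k + 1 = 2 * m"
      using 1 m by simp
    have "dh 1 = (1 + a (2 * m - 1)) / w (2 * m + 1) * d (m + 1)"
      using dh1 \<open>k + 1 = 2 * m\<close> 1
      unfolding d_w[OF m] by (simp add: power2_eq_square algebra_simps)
    then show ?case
      using m by (simp add: w \<alpha>)
  next
    case (2 n)
    \<comment> \<open>An odd shift exchanges the roles of even and odd indices, so the coefficients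
      match only up to factors and terms in \<open>w\<close>.\<close>
    define N where "N = n + m"
    have N: "1 \<le> N" "2 * n + k = 2 * N - 1" "2 * N - 1 - 1 = 2 * N - 2" "2 * N - 1 + 1 = 2 * N"
      using 2 m by (auto simp: N_def)
    have "dh (n + 1) = (1 - a (2 * N - 2)) * (1 - (a (2 * N - 1))\<^sup>2) * (1 + a (2 * N)) / 4"
      using dh[OF 2(2)] by (simp only: N)
    also have "\<dots> = w (2 * N - 1) / w (2 * N + 1) * d (N + 1)"
      unfolding d_w[OF N(1)] w_def[of "2 * N - 1"] N(3)
      by (simp add: power2_eq_square field_simps)
    finally have "dh (n + 1) = w (2 * (n + m) - 1) / w (2 * (n + m) + 1) * d (n + m + 1)"
      by (simp only: N_def)
    then show ?case
      using m by (simp add: w)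
  next
    case 3
    then show ?case
      unfolding bh1 by (simp add: \<alpha>)
  next
    case (4 n)
    define N where "N = n + m"
    have N: "1 \<le> N" "2 * n + k = 2 * N - 1" "2 * N - 1 - 1 = 2 * N - 2" "2 * N - 1 - 2 = 2 * N - 3"
      using 4 m by (auto simp: N_def)
    have "bh (n + 1) = ((1 - a (2 * N - 2)) * a (2 * N - 1) - (1 + a (2 * N - 2)) * a (2 * N - 3)) / 2"
      using bh[OF 4(2)] by (simp only: N)
    also have "\<dots> = b (N + 1) + w (2 * N - 2) - w (2 * N)"
      using b[OF N(1)] by (simp add: w_def) (simp add: field_simps)
    finally have "bh (n + 1) = b (n + m + 1) + w (2 * (n + m) - 2) - w (2 * (n + m))"
      by (simp only: N_def)
    \<comment> \<open>As \<open>n\<close> and \<open>m\<close> are at least 1, the index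
      \<open>2 * (n + m) - 2\<close> is positive and the formula for \<open>v\<close> applies to
      it.\<close>
    then show ?case
      using m 4 by (simp add: w)
  next
    case 5
    show ?case
    proof (intro conjI allI impI)
      \<comment> \<open>With \<open>p = 1 - a (2m - 1)\<close>: the first factor of
        \<open>d (m + 1)\<close> is \<open>p\<close>, whereas in \<open>dh 1\<close> it is
        \<open>1 - (- 1) = 2\<close>. Their ratio is the stated \<lambda>.\<close>
      have "x * y / 2 = 2 / p * (p * x * y / 4)" if "p \<noteq> 0" for p x y :: real
        using that by simp
      from this[OF a_neq(1)] have "dh 1 = 2 / (1 - a (2 * m - 1)) * d (m + 1)"
        unfolding d[OF m] dh1 5 .
      then show "complex_of_real (dh 1) = 2 / (1 - \<alpha> (2 * m - 1)) * complex_of_real (d (m + 1))"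
        by (simp add: \<alpha>)
      show "complex_of_real (bh 1) = \<alpha> (2 * m)"
        using 5 unfolding bh1 by (simp add: \<alpha>)
      fix n :: nat
      assume "1 \<le> n"
      then have "1 \<le> n + m"
        by simp
      \<comment> \<open>An even shift preserves parity: \<open>2n + k = 2 (n + m)\<close> makes the
        two pairs of formulas identical.\<close>
      then show "dh (n + 1) = d (n + m + 1)" "bh (n + 1) = b (n + m + 1)"
        using bh[OF \<open>1 \<le> n\<close>] dh[OF \<open>1 \<le> n\<close>] b[of "n + m"] d[of "n + m"] 5
        by (simp_all add: distrib_left)
    qed
  qed
qed

end
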